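(* As $n\to\infty$, \[ \mathrm{rex}(n, C_4) \geq \left( \frac{1}{2\sqrt{6}} - o(1) \right) n^{3/2}. \]
   Context: All graphs are finite and simple. For a graph $F$, $\mathrm{rex}(n,F)$ (the regular Turán number of $F$) denotes the maximum number of edges in an $n$-vertex graph that is regular (every vertex has the same degree) and contains no subgraph isomorphic to $F$. $C_4$ is the cycle on $4$ vertices. *)

theory Defs
  imports Complex_Main "HOL-Library.Landau_Symbols"
begin

text \<open>A graph is a pair of a vertex set and a set of edges, each edge being a two-element set of
  vertices; so loops and multiple edges are excluded.\<close>

type_synonym 'a graph = "'a set \<times> 'a set set"

abbreviation verts :: "'a graph \<Rightarrow> 'a set" where "verts G \<equiv> fst G"

abbreviation edges :: "'a graph \<Rightarrow> 'a set set" where "edges G \<equiv> snd G"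

definition finite_simple_graph :: "'a graph \<Rightarrow> bool" where
  "finite_simple_graph G \<longleftrightarrow>
     finite (verts G) \<and> (\<forall>e \<in> edges G. e \<subseteq> verts G \<and> card e = 2)"

definition degree :: "'a graph \<Rightarrow> 'a \<Rightarrow> nat" where
  "degree G v = card {e \<in> edges G. v \<in> e}"

definition regular :: "'a graph \<Rightarrow> bool" where
  "regular G \<longleftrightarrow> (\<exists>d. \<forall>v \<in> verts G. degree G v = d)"

definition subgraph :: "'a graph \<Rightarrow> 'a graph \<Rightarrow> bool" where
  "subgraph H G \<longleftrightarrow>
     finite_simple_graph H \<and> verts H \<subseteq> verts G \<and> edges H \<subseteq> edges G"

definition isomorphic :: "'a graph \<Rightarrow> 'b graph \<Rightarrow> bool" where
  "isomorphic G H \<longleftrightarrow>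
     (\<exists>f. bij_betw f (verts G) (verts H) \<and>
          (\<forall>u \<in> verts G. \<forall>v \<in> verts G. {u, v} \<in> edges G \<longleftrightarrow> {f u, f v} \<in> edges H))"

definition contains_copy :: "'a graph \<Rightarrow> 'b graph \<Rightarrow> bool" where
  "contains_copy G F \<longleftrightarrow> (\<exists>H. subgraph H G \<and> isomorphic H F)"

text \<open>Every \<open>n\<close>-vertex graph is isomorphic to one whose vertices are natural numbers, so the vertex
  type is fixed to \<^typ>\<open>nat\<close>.\<close>

definition regular_free_graphs :: "nat \<Rightarrow> 'b graph \<Rightarrow> nat graph set" where
  "regular_free_graphs n F =
     {G. finite_simple_graph G \<and> card (verts G) = n \<and> regular G \<and> \<not> contains_copy G F}"

definition rex :: "nat \<Rightarrow> 'b graph \<Rightarrow> nat" where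
  "rex n F = Max ((\<lambda>G. card (edges G)) ` regular_free_graphs n F)"

text \<open>The cycle on vertices \<open>0, \<dots>, k - 1\<close>; meant for \<open>k \<ge> 3\<close>.\<close>

definition cycle_graph :: "nat \<Rightarrow> nat graph" where
  "cycle_graph k = ({..<k}, {{i, Suc i mod k} | i. i < k})"

abbreviation C4 :: "nat graph" where "C4 \<equiv> cycle_graph 4"

text \<open>The maximum in \<^const>\<open>rex\<close> ranges over a finite set, which is nonempty as soon as \<open>F\<close> has
  an edge (the edgeless graph is a candidate).\<close>

lemma finite_rex_candidates: "finite ((\<lambda>G. card (edges G)) ` regular_free_graphs n F)"
proof (rule finite_subset)
  show "(\<lambda>G. card (edges G)) ` regular_free_graphs n F \<subseteq> {..2 ^ n}"
  proof
    fix m assume "m \<in> (\<lambda>G. card (edges G)) ` regular_free_graphs n F"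
    then obtain G :: "nat graph" where G: "m = card (edges G)" "finite_simple_graph G" "card (verts G) = n"
      by (auto simp: regular_free_graphs_def)
    have "edges G \<subseteq> Pow (verts G)" "finite (Pow (verts G))"
      using G(2) by (auto simp: finite_simple_graph_def)
    then have "card (edges G) \<le> card (Pow (verts G))" by (simp add: card_mono)
    then show "m \<in> {..2 ^ n}" using G by (simp add: card_Pow finite_simple_graph_def)
  qed
qed simp

lemma rex_candidates_nonempty:
  assumes "finite_simple_graph F" "edges F \<noteq> {}"
  shows "regular_free_graphs n F \<noteq> {}"
proof -
  let ?G = "({..<n}, {}) :: nat graph"
  obtain x y where xy: "{x, y} \<in> edges F" "x \<in> verts F" "y \<in> verts F"
    using assms by (fastforce simp: finite_simple_graph_def card_2_iff)
  have "\<not> contains_copy ?G F"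
  proof
    assume "contains_copy ?G F"
    then obtain H :: "nat graph" where H: "edges H = {}" "isomorphic H F"
      unfolding contains_copy_def subgraph_def by auto
    then obtain f where f: "bij_betw f (verts H) (verts F)"
      "\<forall>u \<in> verts H. \<forall>v \<in> verts H. {f u, f v} \<notin> edges F"
      by (auto simp: isomorphic_def)
    then obtain u v where "u \<in> verts H" "v \<in> verts H" "f u = x" "f v = y"
      using xy by (metis bij_betw_imp_surj_on imageE)
    with f(2) xy(1) show False by blast
  qed
  then have "?G \<in> regular_free_graphs n F"
    by (simp add: regular_free_graphs_def finite_simple_graph_def regular_def degree_def)
  then show ?thesis by blast
qed

lemma C4_eq: "C4 = ({0, 1, 2, 3}, {{0, 1}, {1, 2}, {2, 3}, {3, 0}})"
proof -
  have "{..<4::nat} = {0, 1, 2, 3}" by auto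
  moreover have "{{i, Suc i mod 4} | i. i < 4} = (\<lambda>i. {i, (i + 1) mod 4}) ` {..<4::nat}" by auto
  ultimately show ?thesis unfolding cycle_graph_def by (simp add: numeral_2_eq_2[symmetric])
qed

lemma finite_simple_graph_C4: "finite_simple_graph C4"
  by (simp add: C4_eq finite_simple_graph_def)

end

theory Submission
  imports Defs "HOL-Number_Theory.Prime_Powers" "HOL-Number_Theory.Cong"
    "HOL-Real_Asymp.Real_Asymp"
begin

text \<open>
  Fix a prime \<open>p\<close> with \<open>2 p\<^sup>2 \<le> n \<le> 3 p\<^sup>2\<close>, write \<open>n = s p + 2 k\<close> with \<open>k < p\<close>, and let \<open>H\<close> be the
  circulant graph on \<open>\<int>/s\<close> in which \<open>i\<close> and \<open>j\<close> are adjacent iff their cyclic distance is at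
  most \<open>h \<approx> s/6\<close>. The labels \<open>l i = i mod \<lceil>s/3\<rceil>\<close> are distinct on every neighbourhood of \<open>H\<close>,
  so the graph on \<open>V(H) \<times> F\<^sub>p\<close> with \<open>(i, y) \<sim> (j, z)\<close> iff \<open>i \<sim> j\<close> in \<open>H\<close> and \<open>y + z = l i * l j\<close> is
  \<open>2h\<close>-regular, and a 4-cycle would force \<open>(l i - l i') * (l j - l j') = 0\<close>. Two vertices with the same
  first coordinate have no common neighbour; hence for a pair of adjacent classes one may delete
  \<open>2h\<close> of the matching edges between them and join their endpoints to two new vertices, one per
  class. This keeps the graph regular and free of 4-cycles, and doing it for \<open>k\<close> disjoint pairs
  gives exactly \<open>n\<close> vertices. The degree is about \<open>s/3 \<approx> n/(3p) \<ge> sqrt (2n)/3\<close>, which exceeds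
  \<open>sqrt (n/6)\<close>, so the error term can be taken to be 0.

  The prime must lie in an interval with endpoint ratio \<open>sqrt (3/2) > 6/5\<close>, so Chebyshev's
  bounds suffice in place of the prime number theorem.
\<close>

section \<open>Chebyshev's theorem with ratio 6/5\<close>

definition chebyshev_psi :: "nat \<Rightarrow> real" where
  "chebyshev_psi x = (\<Sum>d = 1..x. mangoldt d)"

lemma chebyshev_psi_mono: "x \<le> y \<Longrightarrow> chebyshev_psi x \<le> chebyshev_psi y"
  unfolding chebyshev_psi_def by (intro sum_mono2) (auto intro: mangoldt_nonneg)

text \<open>Legendre's formula, by induction: \<open>n div d\<close> jumps by one exactly when
  \<open>d\<close> divides \<open>Suc n\<close>, and the von Mangoldt values at the divisors of
  \<open>Suc n\<close> add up to its logarithm. The free upper limit \<open>N\<close> lets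
  factorials of different sizes share one summation range.\<close>

lemma ln_fact_eq_sum_mangoldt:
  "n \<le> N \<Longrightarrow> ln (fact n) = (\<Sum>d = 1..N. mangoldt d * real (n div d))"
proof (induction n)
  case (Suc n)
  have "(\<Sum>d = 1..N. mangoldt d * real (Suc n div d)) =
        (\<Sum>d = 1..N. mangoldt d * real (n div d) + (if d dvd Suc n then mangoldt d else 0))"
    by (intro sum.cong) (auto simp: div_Suc algebra_simps mod_eq_0_iff_dvd)
  also have "\<dots> = ln (fact n) + (\<Sum>d | d \<in> {1..N} \<and> d dvd Suc n. mangoldt d)"
    using Suc by (simp add: sum.distrib sum.inter_filter[symmetric])
  also have "{d. d \<in> {1..N} \<and> d dvd Suc n} = {d. d dvd Suc n}"
    using Suc.prems by (auto simp: Suc_le_eq intro: Nat.gr0I dest: dvd_imp_le)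
  also have "(\<Sum>d | d dvd Suc n. mangoldt d) = ln (real (Suc n))"
    using mangoldt_sum[of "Suc n", where ?'a = real] by simp
  also have "ln (fact n) + ln (real (Suc n)) = ln (fact (Suc n) :: real)"
    by (simp add: ln_mult fact_Suc del: of_nat_Suc)
  finally show ?case by simp
qed simp

text \<open>Since 30 - 15 - 10 - 6 + 1 = 0, the alternating sum of these quotients has period 30 in
  \<open>u\<close>, so one period is checked. Terms are moved across to avoid truncated
  subtraction.\<close>

lemma chebyshev_coefficients:
  fixes u :: nat
  shows "u div 2 + u div 3 + u div 5 \<le> u + u div 30"
    and "u + u div 30 \<le> u div 2 + u div 3 + u div 5 + 1"
    and "1 \<le> u \<Longrightarrow> u < 6 \<Longrightarrow> u + u div 30 = u div 2 + u div 3 + u div 5 + 1"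
proof -
  define q r where "q = u div 30" and "r = u mod 30"
  have u: "u = 30 * q + r" and "r < 30" by (simp_all add: q_def r_def)
  have div: "u div 2 = 15 * q + r div 2" "u div 3 = 10 * q + r div 3"
    "u div 5 = 6 * q + r div 5" "u div 30 = q"
    using div_mult_self2[of 2 r "15 * q"] div_mult_self2[of 3 r "10 * q"]
      div_mult_self2[of 5 r "6 * q"] \<open>r < 30\<close>
    by (simp_all add: u add.commute)
  have "\<forall>r\<in>set [0..<30]. r div 2 + r div 3 + r div 5 \<le> r \<and> r \<le> r div 2 + r div 3 + r div 5 + (1::nat)"
    by (simp add: upt_rec)
  from bspec[OF this, of r]
  have r: "r div 2 + r div 3 + r div 5 \<le> r \<and> r \<le> r div 2 + r div 3 + r div 5 + 1"
    using \<open>r < 30\<close> by simp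
  show "u div 2 + u div 3 + u div 5 \<le> u + u div 30" "u + u div 30 \<le> u div 2 + u div 3 + u div 5 + 1"
    using r unfolding div by (simp_all add: u)
  assume "1 \<le> u" "u < 6"
  hence "u = 1 \<or> u = 2 \<or> u = 3 \<or> u = 4 \<or> u = 5" by linarith
  thus "u + u div 30 = u div 2 + u div 3 + u div 5 + 1" by (elim disjE) simp_all
qed

text \<open>Chebyshev's combination of factorials: the signed reciprocals of 1, 2, 3, 5, 30 sum to
  0, so the terms of order \<open>x * ln x\<close> cancel.\<close>

definition chebyshev_E :: "nat \<Rightarrow> real" where
  "chebyshev_E x = ln (fact x) - ln (fact (x div 2)) - ln (fact (x div 3)) - ln (fact (x div 5))
     + ln (fact (x div 30))"

lemma chebyshev_E_eq_sum:
  "chebyshev_E x = (\<Sum>d = 1..x. mangoldt d * (real (x div d) - real (x div d div 2)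
     - real (x div d div 3) - real (x div d div 5) + real (x div d div 30)))"
proof -
  have *: "ln (fact (x div k)) = (\<Sum>d = 1..x. mangoldt d * real (x div d div k))" for k
    using ln_fact_eq_sum_mangoldt[of "x div k" x]
    by (simp add: div_le_dividend div_mult2_eq[symmetric] mult.commute)
  show ?thesis
    unfolding chebyshev_E_def * using *[of 1]
    by (simp add: sum_subtractf[symmetric] sum.distrib[symmetric] algebra_simps)
qed

lemma chebyshev_E_le_psi: "chebyshev_E x \<le> chebyshev_psi x"
  unfolding chebyshev_E_eq_sum chebyshev_psi_def
proof (intro sum_mono)
  fix d
  have "real (x div d) - real (x div d div 2) - real (x div d div 3) - real (x div d div 5)
      + real (x div d div 30) \<le> 1"
    using chebyshev_coefficients(2)[of "x div d"] by linarith
  from mult_left_mono[OF this mangoldt_nonneg[of d]]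
  show "mangoldt d * (real (x div d) - real (x div d div 2) - real (x div d div 3)
      - real (x div d div 5) + real (x div d div 30)) \<le> mangoldt d" by simp
qed

text \<open>All coefficients are nonnegative, and those with \<open>x div 6 < d\<close> equal 1
  because then \<open>x div d\<close> lies between 1 and 5.\<close>

lemma psi_diff_le_chebyshev_E: "chebyshev_psi x - chebyshev_psi (x div 6) \<le> chebyshev_E x"
proof -
  have "chebyshev_psi x = chebyshev_psi (x div 6) + (\<Sum>d = x div 6 + 1..x. mangoldt d)"
    unfolding chebyshev_psi_def
    by (subst sum.union_disjoint [symmetric]) (auto intro!: sum.cong)
  also have "(\<Sum>d = x div 6 + 1..x. mangoldt d) = (\<Sum>d = 1..x. if x div 6 < d then mangoldt d else 0 :: real)"
    by (simp add: sum.inter_filter[symmetric]) (intro sum.cong; auto)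
  also have "\<dots> \<le> chebyshev_E x"
    unfolding chebyshev_E_eq_sum
  proof (intro sum_mono)
    fix d assume d: "d \<in> {1..x}"
    let ?c = "real (x div d) - real (x div d div 2) - real (x div d div 3) - real (x div d div 5)
        + real (x div d div 30)"
    have c: "0 \<le> ?c" using chebyshev_coefficients(1)[of "x div d"] by linarith
    show "(if x div 6 < d then mangoldt d else 0) \<le> mangoldt d * ?c"
    proof (cases "x div 6 < d")
      case True
      have "1 \<le> x div d" "x div d < 6"
        using d True by (auto simp: div_less_iff_less_mult less_eq_div_iff_mult_less_eq algebra_simps)
      from chebyshev_coefficients(3)[OF this] have "?c = 1" by linarith
      thus ?thesis using True by simp
    next
      case False
      thus ?thesis using mult_nonneg_nonneg[OF mangoldt_nonneg[of d] c] by simp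
    qed
  qed
  finally show ?thesis by simp
qed

section \<open>Stirling estimates and the size of Chebyshev's combination\<close>

lemma ln_fact_bounds:
  assumes "n \<ge> 1"
  shows "real n * ln (real n) - real n \<le> ln (fact n)"
    and "ln (fact n) \<le> real n * ln (real n) - real n + ln (real n) + 1"
proof -
  have "real n * ln (real n) - real n \<le> ln (fact n) \<and>
      ln (fact n) \<le> real n * ln (real n) - real n + ln (real n) + 1"
    using assms
  proof (induction n rule: dec_induct)
    case (step n)
    define a where "a = ln (1 + 1 / real n)"
    have n: "real n > 0" using step.hyps by simp
    \<comment> \<open>The induction step needs only 1/(n+1) \<le> \<open>a\<close> \<le> 1/n: the
      right half gives the lower bound on the factorial, the left half the upper one.\<close>
    have "a \<le> 1 / real n" unfolding a_def using n by (intro ln_add_one_self_le_self) auto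
    hence up: "real n * a \<le> 1" using n by (simp add: field_simps)
    have "1 - 1 / (1 + 1 / real n) \<le> a"
      unfolding a_def using n ln_le_minus_one[of "inverse (1 + 1 / real n)"]
        ln_inverse[of "1 + 1 / real n"]
      by (simp add: add_pos_pos inverse_eq_divide del: ln_inverse)
    hence lo: "(real n + 1) * a \<ge> 1" using n by (simp add: field_simps)
    have "real (Suc n) = real n * (1 + 1 / real n)" using n by (simp add: field_simps)
    hence a: "ln (real (Suc n)) = ln (real n) + a"
      unfolding a_def using n by (simp only: ln_mult_pos[OF n] add_pos_pos zero_less_one divide_pos_pos)
    have f: "ln (fact (Suc n) :: real) = ln (fact n) + ln (real (Suc n))"
      using n by (simp add: ln_mult fact_Suc del: of_nat_Suc)
    show ?case unfolding f using step.IH up lo unfolding a by (simp add: algebra_simps)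
  qed simp
  thus "real n * ln (real n) - real n \<le> ln (fact n)"
    and "ln (fact n) \<le> real n * ln (real n) - real n + ln (real n) + 1" by auto
qed

text \<open>Stirling at the integer part of \<open>x / k\<close> costs at most
  \<open>ln x + 1\<close>; restoring the fractional part, which is at most 1, changes t ln t - t by
  at most about its derivative \<open>ln t\<close>.\<close>

lemma ln_fact_div_approx:
  assumes "k \<ge> 1" "x \<ge> k"
  shows "\<bar>ln (fact (x div k)) - real x / real k * (ln (real x) - ln (real k) - 1)\<bar>
    \<le> 2 * ln (real x) + 2"
proof -
  define m where "m = x div k"
  define t where "t = real x / real k"
  have m: "m \<ge> 1" using assms by (simp add: m_def less_eq_div_iff_mult_less_eq)
  have "real m = of_int \<lfloor>t\<rfloor>" unfolding m_def t_def by (simp add: floor_divide_of_nat_eq)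
  hence mt: "real m \<le> t" "t \<le> real m + 1" by linarith+
  have t1: "t \<ge> 1" "t > 0" "ln t \<ge> 0" using m mt by auto
  have tx: "ln t \<le> ln (real x)"
    using assms t1 unfolding t_def by (subst ln_le_cancel_iff) (auto simp: field_simps)
  have lnm: "0 \<le> ln (real m)" "ln (real m) \<le> ln t" using m mt by auto
  have lnt: "ln t = ln (real x) - ln (real k)" using assms by (simp add: t_def ln_div)
  define g where "g = ln t - ln (real m)"
  have g: "g = ln (t / real m)" using m t1 by (simp add: g_def ln_div)
  have "g \<le> t / real m - 1" unfolding g using m t1 by (intro ln_le_minus_one) auto
  hence g1: "real m * g \<le> t - real m" using m by (simp add: field_simps)
  have g0: "g \<ge> 0" using lnm by (simp add: g_def)
  have s: "0 \<le> t - real m" "t - real m \<le> 1" using mt by auto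
  have "t * (ln t - 1) - (real m * ln (real m) - real m)
      = (t - real m) * ln t + real m * g - (t - real m)"
    by (simp add: g_def algebra_simps)
  moreover have "(t - real m) * ln t \<le> 1 * ln t" "0 \<le> (t - real m) * ln t" "0 \<le> real m * g"
    using s t1 g0 by (intro mult_right_mono mult_nonneg_nonneg; simp)+
  ultimately have "\<bar>ln (fact m) - t * (ln t - 1)\<bar> \<le> 2 * ln (real x) + 2"
    using ln_fact_bounds[OF m] g1 s tx lnm by linarith
  thus ?thesis unfolding lnt by (simp add: m_def t_def)
qed

text \<open>Chebyshev's constant, about 0.921: the linear coefficient that survives the cancellation
  in \<open>chebyshev_E\<close>.\<close>

definition chebyshev_const :: real where
  "chebyshev_const = ln 2 / 2 + ln 3 / 3 + ln 5 / 5 - ln 30 / 30"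

lemma chebyshev_const_pos: "chebyshev_const > 0"
proof -
  have "ln (30::real) = ln 2 + ln 3 + ln 5"
    using ln_mult[of "2::real" 15] ln_mult[of "3::real" 5] by simp
  thus ?thesis unfolding chebyshev_const_def by (simp add: field_simps add_pos_pos)
qed

lemma chebyshev_E_approx:
  assumes "x \<ge> 30"
  shows "\<bar>chebyshev_E x - chebyshev_const * real x\<bar> \<le> 10 * ln (real x) + 10"
proof -
  define g where "g k = real x / real k * (ln (real x) - ln (real k) - 1)" for k
  have "chebyshev_const * real x = g 1 - g 2 - g 3 - g 5 + g 30"
    by (simp add: chebyshev_const_def g_def field_simps)
  moreover have "\<bar>ln (fact (x div k)) - g k\<bar> \<le> 2 * ln (real x) + 2" if "k \<in> {1, 2, 3, 5, 30}" for k
    unfolding g_def using assms that by (intro ln_fact_div_approx) auto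
  from this[of 1] this[of 2] this[of 3] this[of 5] this[of 30]
  have "\<bar>ln (fact x) - g 1\<bar> \<le> 2 * ln (real x) + 2"
    "\<bar>ln (fact (x div 2)) - g 2\<bar> \<le> 2 * ln (real x) + 2"
    "\<bar>ln (fact (x div 3)) - g 3\<bar> \<le> 2 * ln (real x) + 2"
    "\<bar>ln (fact (x div 5)) - g 5\<bar> \<le> 2 * ln (real x) + 2"
    "\<bar>ln (fact (x div 30)) - g 30\<bar> \<le> 2 * ln (real x) + 2"
    by simp_all
  ultimately show ?thesis unfolding chebyshev_E_def abs_le_iff by linarith
qed

text \<open>Iterating the bound on \<open>chebyshev_psi x - chebyshev_psi (x div 6)\<close> sums the
  geometric series 1 + 1/6 + 1/36 + ... = 6/5. The slack in \<open>c\<close> absorbs the logarithmic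
  error for large \<open>x\<close>, and \<open>M\<close> covers the rest.\<close>

lemma chebyshev_psi_upper:
  assumes "c > chebyshev_const"
  obtains M where "\<And>x. chebyshev_psi x \<le> 6 / 5 * c * real x + M"
proof -
  have "eventually (\<lambda>x::nat. chebyshev_const * real x + (10 * ln (real x) + 10) \<le> c * real x) at_top"
    using assms by real_asymp
  then obtain N where N: "\<And>x. x \<ge> N \<Longrightarrow>
      chebyshev_const * real x + (10 * ln (real x) + 10) \<le> c * real x"
    by (auto simp: eventually_at_top_linorder)
  have c: "c > 0" using assms chebyshev_const_pos by linarith
  have "chebyshev_psi x \<le> 6 / 5 * c * real x + chebyshev_psi (N + 30)" for x
  proof (induction x rule: less_induct)
    case (less x)
    show ?case
    proof (cases "x \<le> N + 30")
      case True
      have "0 \<le> 6 / 5 * c * real x" using c by simp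
      with chebyshev_psi_mono[OF True] show ?thesis by linarith
    next
      case False
      have "c * real (x div 6) \<le> c * (real x / 6)"
        using c of_nat_div_le_of_nat[of x 6, where ?'a = real] by (intro mult_left_mono) auto
      moreover have "chebyshev_psi (x div 6) \<le> 6 / 5 * c * real (x div 6) + chebyshev_psi (N + 30)"
        using False by (intro less) auto
      ultimately show ?thesis
        using psi_diff_le_chebyshev_E[of x] chebyshev_E_approx[of x] N[of x] False by linarith
    qed
  qed
  thus ?thesis by (rule that)
qed

section \<open>From prime powers to primes\<close>

lemma mangoldt_not_prime_sum_le:
  assumes "x \<ge> 1"
  shows "(\<Sum>d | d \<in> {1..x} \<and> \<not> prime d. mangoldt d) \<le> sqrt (real x) * (log 2 (real x) + 1) * ln (real x)"
proof -
  let ?r = "nat \<lfloor>sqrt (real x)\<rfloor>" and ?l = "nat \<lfloor>log 2 (real x)\<rfloor>"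
  let ?A = "{d \<in> {1..x}. \<not> prime d \<and> primepow d}"
  \<comment> \<open>A proper prime power up to \<open>x\<close> has base at most the square root of
    \<open>x\<close> and exponent at most \<open>log 2 x\<close>.\<close>
  have sub: "?A \<subseteq> (\<lambda>(p, k). p ^ k) ` ({1..?r} \<times> {0..?l})"
  proof
    fix d assume "d \<in> ?A"
    hence d: "d \<le> x" "\<not> prime d" "primepow d" by auto
    then obtain p k where pk: "prime p" "d = p ^ k" "k > 0"
      by (auto simp: primepow_def)
    have p: "p \<ge> 2" using pk prime_ge_2_nat by blast
    have "k \<noteq> 1" using d pk by auto
    hence "p ^ 2 \<le> p ^ k" using pk p by (intro power_increasing) auto
    hence "real (p ^ 2) \<le> real x" using d pk by (subst of_nat_le_iff) linarith
    hence "real p \<le> sqrt (real x)" by (intro real_le_rsqrt) simp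
    hence "p \<le> ?r" by (simp add: le_nat_floor)
    moreover have "2 ^ k \<le> p ^ k" using p by (intro power_mono) auto
    hence "real (2 ^ k) \<le> real x" using d pk by (subst of_nat_le_iff) linarith
    hence "real k \<le> log 2 (real x)" using assms by (subst le_log_iff) (auto simp: powr_realpow)
    hence "k \<le> ?l" by (simp add: le_nat_floor)
    ultimately show "d \<in> (\<lambda>(p, k). p ^ k) ` ({1..?r} \<times> {0..?l})"
      using pk p by (intro image_eqI[of _ _ "(p, k)"]) auto
  qed
  have "card ?A \<le> card ({1..?r} \<times> {0..?l})"
    by (rule surj_card_le[OF _ sub]) simp
  also have "\<dots> = ?r * (?l + 1)" by (simp only: card_cartesian_product card_atLeastAtMost) simp
  finally have "real (card ?A) \<le> real ?r * (real ?l + 1)"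
    by (metis of_nat_1 of_nat_add of_nat_le_iff of_nat_mult)
  also have "\<dots> \<le> sqrt (real x) * (log 2 (real x) + 1)"
    using assms by (intro mult_mono add_mono) (auto simp: of_nat_floor zero_le_log_cancel_iff)
  finally have card: "real (card ?A) \<le> sqrt (real x) * (log 2 (real x) + 1)" .
  have "(\<Sum>d | d \<in> {1..x} \<and> \<not> prime d. mangoldt d) = (\<Sum>d\<in>?A. mangoldt d :: real)"
    by (intro sum.mono_neutral_right) (auto simp: mangoldt_def)
  also have "\<dots> \<le> (\<Sum>d\<in>?A. ln (real x))"
    by (intro sum_mono order.trans[OF mangoldt_le]) auto
  also have "\<dots> \<le> sqrt (real x) * (log 2 (real x) + 1) * ln (real x)"
    using card assms by (simp add: mult_right_mono)
  finally show ?thesis .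
qed

text \<open>Without primes in the interval, \<open>chebyshev_psi\<close> would grow there only
  through proper prime powers, which is of smaller order than the linear gap between its lower bound
  at \<open>x\<close> and its upper bound at \<open>b * x\<close>.\<close>

lemma eventually_prime_between:
  fixes b :: real
  assumes "b < 5 / 6" "b > 0"
  shows "eventually (\<lambda>x::nat. \<exists>p. prime p \<and> b * real x < real p \<and> p \<le> x) at_top"
proof -
  let ?A = chebyshev_const
  \<comment> \<open>The midpoint of \<open>?A\<close> and 5 \<open>?A\<close> / (6
    \<open>b\<close>); this interval is nonempty because \<open>b < 5 / 6\<close>.\<close>
  define c where "c = ?A * (1 + 5 / (6 * b)) / 2"
  have c: "c > ?A" "6 / 5 * c * b < ?A"
    using assms chebyshev_const_pos unfolding c_def by (auto simp: field_simps)
  obtain M where M: "\<And>x. chebyshev_psi x \<le> 6 / 5 * c * real x + M"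
    using chebyshev_psi_upper[OF c(1)] by blast
  have "eventually (\<lambda>x::nat. 6 / 5 * c * b * real x + M +
      sqrt (real x) * (log 2 (real x) + 1) * ln (real x) < ?A * real x - (10 * ln (real x) + 10)) at_top"
    using c(2) by real_asymp
  thus ?thesis using eventually_ge_at_top[of 30]
  proof eventually_elim
    case (elim x)
    define y where "y = nat \<lfloor>b * real x\<rfloor>"
    have y: "real y \<le> b * real x" "b * real x < real y + 1"
      unfolding y_def using assms elim by (auto simp: of_nat_floor)
    have yx: "y \<le> x"
    proof -
      have "b * real x \<le> 1 * real x" using assms by (intro mult_right_mono) auto
      thus ?thesis using y by simp
    qed
    show ?case
    proof (rule ccontr)
      assume no: "\<not> (\<exists>p. prime p \<and> b * real x < real p \<and> p \<le> x)"
      have np: "\<not> prime d" if "d \<in> {y+1..x}" for d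
      proof -
        have "real y + 1 \<le> real d" using that by auto
        thus ?thesis using no that y(2) by force
      qed
      have "chebyshev_psi x = chebyshev_psi y + (\<Sum>d = y + 1..x. mangoldt d)"
        unfolding chebyshev_psi_def using yx
        by (subst sum.union_disjoint [symmetric]) (auto intro!: sum.cong)
      also have "(\<Sum>d = y + 1..x. mangoldt d) \<le> (\<Sum>d | d \<in> {1..x} \<and> \<not> prime d. mangoldt d :: real)"
        using np by (intro sum_mono2) (auto intro: mangoldt_nonneg)
      also have "\<dots> \<le> sqrt (real x) * (log 2 (real x) + 1) * ln (real x)"
        using elim by (intro mangoldt_not_prime_sum_le) auto
      finally have "chebyshev_psi x \<le> chebyshev_psi y + sqrt (real x) * (log 2 (real x) + 1) * ln (real x)"
        by simp
      moreover have "6 / 5 * c * real y \<le> 6 / 5 * c * (b * real x)"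
        using y c(1) chebyshev_const_pos by (intro mult_left_mono) auto
      ultimately show False
        using M[of y] chebyshev_E_le_psi[of x] chebyshev_E_approx[of x] elim by (simp add: mult.assoc)
    qed
  qed
qed

section \<open>Regular graphs without 4-cycles\<close>

lemma handshake:
  assumes "finite_simple_graph G"
  shows "(\<Sum>v\<in>verts G. degree G v) = 2 * card (edges G)"
proof -
  have "edges G \<subseteq> Pow (verts G)" and fin: "finite (verts G)"
    using assms by (auto simp: finite_simple_graph_def)
  hence "finite (edges G)" by (meson finite_Pow_iff finite_subset)
  moreover have "\<forall>e\<in>edges G. card {v \<in> verts G. v \<in> e} = 2"
  proof
    fix e assume "e \<in> edges G"
    hence "e \<subseteq> verts G" "card e = 2" using assms by (auto simp: finite_simple_graph_def)
    moreover from this have "{v \<in> verts G. v \<in> e} = e" by auto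
    ultimately show "card {v \<in> verts G. v \<in> e} = 2" by simp
  qed
  ultimately show ?thesis
    unfolding degree_def using sum_multicount[OF fin, of "edges G" "(\<in>)" 2] by simp
qed

lemma card_edges_le_rex:
  assumes "G \<in> regular_free_graphs n F"
  shows "card (edges G) \<le> rex n F"
  unfolding rex_def using assms by (intro Max_ge finite_rex_candidates imageI)

lemma contains_C4_E:
  assumes "contains_copy G C4"
  obtains a b c d where "{a, b} \<in> edges G" "{b, c} \<in> edges G" "{c, d} \<in> edges G" "{d, a} \<in> edges G"
    "a \<noteq> c" "b \<noteq> d"
proof -
  obtain H f where H: "edges H \<subseteq> edges G"
    and f: "bij_betw f (verts H) (verts C4)"
      "\<And>u v. u \<in> verts H \<Longrightarrow> v \<in> verts H \<Longrightarrow> {u, v} \<in> edges H \<longleftrightarrow> {f u, f v} \<in> edges C4"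
    using assms unfolding contains_copy_def subgraph_def isomorphic_def by auto
  define g where "g = inv_into (verts H) f"
  have g: "g i \<in> verts H" "f (g i) = i" if "i \<in> {0, 1, 2, 3}" for i
    using f(1) that unfolding g_def C4_eq bij_betw_def
    by (auto intro: inv_into_into f_inv_into_f)
  have e: "{g i, g j} \<in> edges G" if "{i, j} \<in> edges C4" "i \<in> {0, 1, 2, 3}" "j \<in> {0, 1, 2, 3}" for i j
    using f(2)[of "g i" "g j"] g that H by auto
  show thesis
  proof (rule that)
    show "{g 0, g 1} \<in> edges G" "{g 1, g 2} \<in> edges G" "{g 2, g 3} \<in> edges G" "{g 3, g 0} \<in> edges G"
      by (rule e; simp add: C4_eq)+
    show "g 0 \<noteq> g 2" using g(2)[of 0] g(2)[of 2] by auto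
    show "g 1 \<noteq> g 3" using g(2)[of 1] g(2)[of 3] by auto
  qed
qed

text \<open>Transfers a graph on any vertex type to vertices \<open>{..<n}\<close>, as
  \<open>rex\<close> demands. A 4-cycle is a pair of distinct vertices with two common neighbours,
  and \<open>d * card V\<close> is twice the number of edges.\<close>

lemma rex_C4_ge:
  fixes adj :: "'a \<Rightarrow> 'a \<Rightarrow> bool"
  assumes fin: "finite V"
    and sym: "\<And>u v. adj u v \<Longrightarrow> adj v u"
    and irrefl: "\<And>u. \<not> adj u u"
    and deg: "\<And>u. u \<in> V \<Longrightarrow> card {v \<in> V. adj u v} = d"
    and codeg: "\<And>u w v v'. \<lbrakk>u \<in> V; w \<in> V; v \<in> V; v' \<in> V;
      adj u v; adj w v; adj u v'; adj w v'; u \<noteq> w; v \<noteq> v'\<rbrakk> \<Longrightarrow> False"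
  shows "d * card V \<le> 2 * rex (card V) C4"
proof -
  define n where "n = card V"
  obtain g where g: "bij_betw g {..<n} V"
    using ex_bij_betw_nat_finite[OF fin] by (auto simp: n_def atLeast0LessThan)
  have gV: "g a \<in> V" if "a < n" for a using g that by (auto simp: bij_betw_def)
  have g_eq: "g a = g b \<longleftrightarrow> a = b" if "a < n" "b < n" for a b
    using g that by (auto simp: bij_betw_def inj_on_def)
  define E where "E = {{a, b} | a b. a < n \<and> b < n \<and> adj (g a) (g b)}"
  define G where "G = ({..<n}, E)"
  have E: "{a, b} \<in> E \<longleftrightarrow> a < n \<and> b < n \<and> adj (g a) (g b)" for a b
    unfolding E_def using sym by (auto simp: doubleton_eq_iff)
  have fsg: "finite_simple_graph G"
    unfolding finite_simple_graph_def G_def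
  proof (intro conjI ballI)
    fix e assume "e \<in> edges ({..<n}, E)"
    then obtain a b where ab: "e = {a, b}" "a < n" "b < n" "adj (g a) (g b)"
      unfolding E_def by auto
    moreover have "a \<noteq> b" using ab irrefl by auto
    ultimately show "e \<subseteq> verts ({..<n}, E)" "card e = 2" by auto
  qed simp
  have deg': "degree G a = d" if a: "a < n" for a
  proof -
    have "{e \<in> E. a \<in> e} = (\<lambda>b. {a, b}) ` {b. b < n \<and> adj (g a) (g b)}"
    proof (intro equalityI subsetI)
      fix e assume "e \<in> {e \<in> E. a \<in> e}"
      then obtain b where "e = {a, b}" "{a, b} \<in> E"
        unfolding E_def by (auto simp: insert_commute)
      thus "e \<in> (\<lambda>b. {a, b}) ` {b. b < n \<and> adj (g a) (g b)}" using E by auto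
    qed (auto simp: E a)
    hence "degree G a = card {b. b < n \<and> adj (g a) (g b)}"
      unfolding degree_def G_def by (simp add: card_image inj_on_def doubleton_eq_iff)
    also have "\<dots> = card (g ` {b. b < n \<and> adj (g a) (g b)})"
      by (intro card_image [symmetric] inj_onI) (auto simp: g_eq)
    also have "g ` {b. b < n \<and> adj (g a) (g b)} = {v \<in> V. adj (g a) v}"
      using g by (auto simp: bij_betw_def)
    finally show ?thesis using deg gV[OF a] by simp
  qed
  have "\<not> contains_copy G C4"
  proof
    assume "contains_copy G C4"
    then obtain a b c d where cyc: "{a, b} \<in> E" "{b, c} \<in> E" "{c, d} \<in> E" "{d, a} \<in> E"
        "a \<noteq> c" "b \<noteq> d"
      by (rule contains_C4_E) (auto simp: G_def)
    thus False
      using codeg[of "g a" "g c" "g b" "g d"] sym gV g_eq unfolding E by auto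
  qed
  hence "G \<in> regular_free_graphs n C4"
    unfolding regular_free_graphs_def regular_def using fsg deg' by (auto simp: G_def)
  hence "card (edges G) \<le> rex n C4" by (rule card_edges_le_rex)
  moreover have "d * n = 2 * card (edges G)"
    using handshake[OF fsg] deg' by (simp add: G_def mult.commute)
  ultimately show ?thesis by (simp add: n_def)
qed

section \<open>The lift of a base graph over a prime field\<close>

lemma cong_add_iff_eq_mod:
  fixes y z a p :: int
  assumes "z \<in> {0..<p}"
  shows "[y + z = a] (mod p) \<longleftrightarrow> z = (a - y) mod p"
proof -
  have *: "[y + z = a] (mod p) \<longleftrightarrow> [z = a - y] (mod p)"
    by (simp add: cong_iff_dvd_diff algebra_simps)
  show ?thesis unfolding * using assms by (simp add: unique_euclidean_semiring_class.cong_def)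
qed

text \<open>\<open>Inl (i, y)\<close> will be the vertex \<open>y\<close> of the class of \<open>i\<close>, and \<open>Inr c\<close> the new vertex attached
  to the class of \<open>c\<close>; the involution \<open>\<pi>\<close> pairs the classes that receive new vertices, and \<open>T c\<close>
  is the set of vertices of the class of \<open>c\<close> that exchange an edge for one to \<open>Inr c\<close>.\<close>

lemma rex_C4_ge_lift:
  fixes H :: "'a \<Rightarrow> 'a \<Rightarrow> bool" and l :: "'a \<Rightarrow> int" and p :: int and T :: "'a \<Rightarrow> int set"
  assumes p: "prime p"
    and I: "finite I" "\<And>i j. H i j \<Longrightarrow> i \<in> I"
    and H: "\<And>i j. H i j \<Longrightarrow> H j i" "\<And>i. \<not> H i i" "\<And>i. i \<in> I \<Longrightarrow> card {j. H i j} = d"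
    and l: "\<And>i j k. H i j \<Longrightarrow> H i k \<Longrightarrow> [l j = l k] (mod p) \<Longrightarrow> j = k"
    and C: "C \<subseteq> I" "\<And>c. c \<in> C \<Longrightarrow> \<pi> c \<in> C" "\<And>c. c \<in> C \<Longrightarrow> \<pi> (\<pi> c) = c"
      "\<And>c. c \<in> C \<Longrightarrow> H c (\<pi> c)"
    and T: "\<And>c. c \<in> C \<Longrightarrow> T c \<subseteq> {0..<p}" "\<And>c. c \<in> C \<Longrightarrow> card (T c) = d"
      "\<And>c y z. \<lbrakk>c \<in> C; y \<in> {0..<p}; z \<in> {0..<p}; [y + z = l c * l (\<pi> c)] (mod p)\<rbrakk>
        \<Longrightarrow> y \<in> T c \<longleftrightarrow> z \<in> T (\<pi> c)"
  shows "d * (card I * nat p + card C) \<le> 2 * rex (card I * nat p + card C) C4"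
proof -
  define V where "V = (I \<times> {0..<p}) <+> C"
  define adj where "adj u v = (case u of
      Inl (i, y) \<Rightarrow> (case v of
        Inl (j, z) \<Rightarrow> H i j \<and> [y + z = l i * l j] (mod p) \<and> y \<in> {0..<p} \<and> z \<in> {0..<p}
          \<and> \<not> (i \<in> C \<and> j = \<pi> i \<and> y \<in> T i)
      | Inr c \<Rightarrow> c \<in> C \<and> i = c \<and> y \<in> T c)
    | Inr c \<Rightarrow> (case v of
        Inl (j, z) \<Rightarrow> c \<in> C \<and> j = c \<and> z \<in> T c
      | Inr _ \<Rightarrow> False))" for u v :: "('a \<times> int) + 'a"
  have adj_simps:
    "adj (Inl (i, y)) (Inl (j, z)) \<longleftrightarrow> H i j \<and> [y + z = l i * l j] (mod p) \<and> y \<in> {0..<p} \<and> z \<in> {0..<p}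
      \<and> \<not> (i \<in> C \<and> j = \<pi> i \<and> y \<in> T i)"
    "adj (Inl (i, y)) (Inr c) \<longleftrightarrow> c \<in> C \<and> i = c \<and> y \<in> T c"
    "adj (Inr c) (Inl (i, y)) \<longleftrightarrow> c \<in> C \<and> i = c \<and> y \<in> T c"
    "\<not> adj (Inr c) (Inr c')" for i y j z c c'
    by (simp_all add: adj_def)
  have p0: "p > 0" using p by (simp add: prime_gt_0_int)
  have I': "j \<in> I" if "H i j" for i j using that H(1) I(2) by blast
  have finH: "finite {j. H i j}" for i
    using I' by (intro finite_subset[OF _ I(1)]) auto
  have finV: "finite V"
    unfolding V_def using I(1) C(1) by (auto intro: finite_subset)
  have cardV: "card V = card I * nat p + card C"
    unfolding V_def using I(1) finite_subset[OF C(1) I(1)]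
    by (simp add: card_Plus card_cartesian_product)
  have sym: "adj v u" if "adj u v" for u v
  proof (cases "isl u \<and> isl v")
    case True
    then obtain i y j z where iy: "u = Inl (i, y)" "v = Inl (j, z)"
      by (auto simp: isl_def)
    have uv: "H i j" "[y + z = l i * l j] (mod p)" "y \<in> {0..<p}" "z \<in> {0..<p}"
        "\<not> (i \<in> C \<and> j = \<pi> i \<and> y \<in> T i)"
      using that by (simp_all add: adj_simps iy)
    \<comment> \<open>Deletion is phrased from one endpoint only; it is symmetric because
      \<open>T\<close> contains a vertex iff the set of the paired class contains its matching
      partner.\<close>
    have "\<not> (j \<in> C \<and> i = \<pi> j \<and> z \<in> T j)"
    proof
      assume *: "j \<in> C \<and> i = \<pi> j \<and> z \<in> T j"
      hence "i \<in> C" "j = \<pi> i" using C(2)[of j] C(3)[of j] by simp_all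
      thus False using uv * T(3)[of i y z] by blast
    qed
    thus "adj v u" using uv H(1) by (simp add: adj_simps iy add.commute mult.commute)
  next
    case False
    thus ?thesis using that by (cases u; cases v) (auto simp: adj_simps)
  qed
  have irrefl: "\<not> adj u u" for u
    by (cases u) (auto simp: adj_simps H(2))
  have deg: "card {v \<in> V. adj u v} = d" if u: "u \<in> V" for u
  proof (cases u)
    case (Inr c)
    hence c: "c \<in> C" using u by (auto simp: V_def)
    have "{v \<in> V. adj u v} = Inl ` ({c} \<times> T c)"
      using c C(1) T(1)[OF c] by (auto simp: V_def adj_simps Inr split: sum.splits)
    thus ?thesis using T(2)[OF c] by (simp add: card_image card_cartesian_product)
  next
    case (Inl a)
    then obtain i y where a: "u = Inl (i, y)" by (cases a) auto
    have iy: "i \<in> I" "y \<in> {0..<p}" using u a by (auto simp: V_def)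
    \<comment> \<open>The only possible neighbour of \<open>u\<close> in the class of
      \<open>j\<close>.\<close>
    define g where "g j = (Inl (j, (l i * l j - y) mod p) :: ('a \<times> int) + 'a)" for j
    have inj: "inj_on g A" for A by (auto simp: inj_on_def g_def)
    have g: "adj u (Inl (j, z)) \<longleftrightarrow> H i j \<and> Inl (j, z) = g j \<and> \<not> (i \<in> C \<and> j = \<pi> i \<and> y \<in> T i)" for j z
      using iy p0 cong_add_iff_eq_mod[of z p y "l i * l j"] by (auto simp: adj_simps a g_def)
    have gV: "g j \<in> V" if "H i j" for j using I'[OF that] p0 by (auto simp: V_def g_def)
    show ?thesis
    proof (cases "i \<in> C \<and> y \<in> T i")
      case False
      have "{v \<in> V. adj u v} = g ` {j. H i j}"
      proof (intro equalityI subsetI)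
        fix v assume v: "v \<in> {v \<in> V. adj u v}"
        then obtain j z where "v = Inl (j, z)"
          using False by (cases v) (auto simp: adj_simps a)
        thus "v \<in> g ` {j. H i j}" using v g by auto
      next
        fix v assume "v \<in> g ` {j. H i j}"
        then obtain j where "v = g j" "H i j" by auto
        thus "v \<in> {v \<in> V. adj u v}" using g[of j "(l i * l j - y) mod p"] gV False by (auto simp: g_def)
      qed
      thus ?thesis using H(3)[OF iy(1)] by (simp add: card_image[OF inj])
    next
      case True
      \<comment> \<open>The partner in the class of \<open>\<pi> i\<close> is traded for
        \<open>Inr i\<close>, so the degree is unchanged.\<close>
      have "{v \<in> V. adj u v} = insert (Inr i) (g ` ({j. H i j} - {\<pi> i}))"
      proof (intro equalityI subsetI)
        fix v assume v: "v \<in> {v \<in> V. adj u v}"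
        show "v \<in> insert (Inr i) (g ` ({j. H i j} - {\<pi> i}))"
        proof (cases v)
          case (Inl b)
          thus ?thesis using v g True by (cases b) auto
        qed (use v in \<open>auto simp: adj_simps a\<close>)
      next
        fix v assume "v \<in> insert (Inr i) (g ` ({j. H i j} - {\<pi> i}))"
        then consider "v = Inr i" | j where "v = g j" "H i j" "j \<noteq> \<pi> i" by auto
        thus "v \<in> {v \<in> V. adj u v}"
        proof cases
          case 1
          thus ?thesis using True by (auto simp: adj_simps a V_def)
        next
          case 2
          thus ?thesis using g[of j "(l i * l j - y) mod p"] gV by (auto simp: g_def)
        qed
      qed
      moreover have "Inr i \<notin> g ` A" for A by (auto simp: g_def)
      moreover have "\<pi> i \<in> {j. H i j}" using C(4) True by simp
      moreover have "card {j. H i j} > 0"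
        using \<open>\<pi> i \<in> {j. H i j}\<close> finH by (auto simp: card_gt_0_iff)
      ultimately show ?thesis
        using H(3)[OF iy(1)] finH[of i] by (simp add: card_image[OF inj])
    qed
  qed
  \<comment> \<open>Both neighbours of a new vertex lie in one class, where any other vertex has at
    most one neighbour.\<close>
  have new: False
    if adj: "adj (Inr c) v" "adj w v" "adj (Inr c) v'" "adj w v'" "Inr c \<noteq> w" "v \<noteq> v'" for c v v' w
  proof -
    obtain z z' where z: "v = Inl (c, z)" "v' = Inl (c, z')" "c \<in> C"
      using adj by (cases v; cases v') (auto simp: adj_simps)
    obtain i y where w: "w = Inl (i, y)"
      using adj z by (cases w) (auto simp: adj_simps)
    have "z \<in> {0..<p}" "z' \<in> {0..<p}" "[y + z = l i * l c] (mod p)" "[y + z' = l i * l c] (mod p)"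
      using adj z w by (auto simp: adj_simps)
    hence "z = z'" by (simp add: cong_add_iff_eq_mod)
    thus False using adj z by simp
  qed
  have codeg: False
    if adj: "adj u v" "adj w v" "adj u v'" "adj w v'" "u \<noteq> w" "v \<noteq> v'" for u v v' w
  proof -
    have "\<not> isl x \<Longrightarrow> \<exists>c. x = Inr c" for x :: "('a \<times> int) + 'a" by (cases x) auto
    \<comment> \<open>By rotating the cycle, \<open>new\<close> applies to each of its four
      vertices.\<close>
    hence "isl u" "isl w" "isl v" "isl v'"
      using new adj sym by metis+
    then obtain i y i' y' j z j' z' where eq: "u = Inl (i, y)" "w = Inl (i', y')"
        "v = Inl (j, z)" "v' = Inl (j', z')"
      by (auto simp: isl_def)
    have h: "H i j" "H i' j" "H i j'" "H i' j'"
      and r: "y \<in> {0..<p}" "y' \<in> {0..<p}" "z \<in> {0..<p}" "z' \<in> {0..<p}"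
      and c: "[y + z = l i * l j] (mod p)" "[y' + z = l i' * l j] (mod p)"
        "[y + z' = l i * l j'] (mod p)" "[y' + z' = l i' * l j'] (mod p)"
      using adj by (auto simp: adj_simps eq)
    \<comment> \<open>The alternating sum of the four edge equations eliminates the second
      coordinates and leaves a product of label differences.\<close>
    have "[((y + z) - (y' + z)) - ((y + z') - (y' + z')) =
        (l i * l j - l i' * l j) - (l i * l j' - l i' * l j')] (mod p)"
      by (intro cong_diff c)
    hence "p dvd (l i - l i') * (l j - l j')"
      by (simp add: cong_iff_dvd_diff algebra_simps)
         (smt (verit) dvd_minus_iff)
    hence "[l i = l i'] (mod p) \<or> [l j = l j'] (mod p)"
      using p by (simp add: prime_dvd_mult_iff cong_iff_dvd_diff)
    thus False
    proof
      assume "[l i = l i'] (mod p)"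
      hence "i = i'" using l[of j i i'] h H(1) by blast
      hence "y = y'"
        using c(1,2) r cong_add_iff_eq_mod[of y p z] cong_add_iff_eq_mod[of y' p z]
        by (simp add: add.commute)
      thus False using adj \<open>i = i'\<close> by (simp add: eq)
    next
      assume "[l j = l j'] (mod p)"
      hence "j = j'" using l[of i j j'] h by blast
      hence "z = z'"
        using c(1,3) r cong_add_iff_eq_mod[of z p y] cong_add_iff_eq_mod[of z' p y] by simp
      thus False using adj \<open>j = j'\<close> by (simp add: eq)
    qed
  qed
  show ?thesis
    using rex_C4_ge[OF finV, of adj d] sym irrefl deg codeg unfolding cardV by blast
qed

section \<open>The circulant base graph\<close>

lemma mod_circulant_iff:
  fixes x s h :: int
  assumes "0 \<le> h" "2 * h < s"
  shows "x mod s \<in> {1..h} \<union> {s - h..<s} \<longleftrightarrow> (\<exists>t e. x = t + s * e \<and> t \<noteq> 0 \<and> \<bar>t\<bar> \<le> h)"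
proof
  assume x: "x mod s \<in> {1..h} \<union> {s - h..<s}"
  have eq: "x = x mod s + s * (x div s)" by simp
  show "\<exists>t e. x = t + s * e \<and> t \<noteq> 0 \<and> \<bar>t\<bar> \<le> h"
  proof (cases "x mod s \<le> h")
    case True
    with x assms eq show ?thesis by (intro exI[of _ "x mod s"] exI[of _ "x div s"]) auto
  next
    case False
    have "x = (x mod s - s) + s * (x div s + 1)" by (simp add: algebra_simps)
    moreover have "x mod s < s" "s - h \<le> x mod s" using x assms False by auto
    hence "x mod s - s \<noteq> 0 \<and> \<bar>x mod s - s\<bar> \<le> h" by linarith
    ultimately show ?thesis by blast
  qed
next
  assume "\<exists>t e. x = t + s * e \<and> t \<noteq> 0 \<and> \<bar>t\<bar> \<le> h"
  then obtain t e where t: "x = t + s * e" "t \<noteq> 0" "\<bar>t\<bar> \<le> h" by blast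
  have x: "x mod s = t mod s" by (simp add: t)
  show "x mod s \<in> {1..h} \<union> {s - h..<s}"
  proof (cases "t > 0")
    case True
    thus ?thesis unfolding x using t assms by simp
  next
    case False
    have "t mod s = (t + s) mod s" by simp
    also have "\<dots> = t + s" using False t assms by (intro mod_pos_pos_trivial) auto
    finally show ?thesis unfolding x using False t assms by auto
  qed
qed

text \<open>\<open>h \<ge> 1\<close> makes consecutive classes adjacent, and
  \<open>2 * k \<le> s\<close> leaves room for \<open>k\<close> pairs of them. The bounds on
  \<open>q\<close> make labels injective on neighbourhoods: offsets of two neighbours differ by at
  most \<open>2 * h < q\<close>, wrapping around is excluded by \<open>2 * q + 2 * h < s\<close> and
  \<open>s \<le> 3 * q\<close>, and \<open>q \<le> p\<close> keeps distinct labels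
  incongruent.\<close>

lemma rex_C4_ge_circulant:
  fixes p s h q k :: nat
  assumes p: "prime p" and h: "h \<ge> 1" "2 * h < q" and q: "q \<le> p" "2 * q + 2 * h < s" "s \<le> 3 * q"
    and k: "2 * k \<le> s"
  shows "2 * h * (s * p + 2 * k) \<le> 2 * rex (s * p + 2 * k) C4"
proof -
  define I where "I = {0..<int s}"
  define D where "D = {1..int h} \<union> {int s - int h..<int s}"
  define H where "H i j \<longleftrightarrow> i \<in> I \<and> j \<in> I \<and> (j - i) mod int s \<in> D" for i j
  define l where "l i = i mod int q" for i
  define C where "C = {0..<2 * int k}"
  define \<pi> where "\<pi> c = (if even c then c + 1 else c - 1)" for c :: int
  \<comment> \<open>An even class gives up its first \<open>2 * h\<close> vertices, and the odd
    class paired with it gives up their matching partners.\<close>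
  define T where "T c = {y \<in> {0..<int p}.
      (if even c then y else (l c * l (c - 1) - y) mod int p) < 2 * int h}" for c
  have s: "2 * int h < int s" using q by linarith
  \<comment> \<open>Signed offset \<open>t\<close> and lap number \<open>e\<close>: a form in which
    negating and subtracting steps is immediate.\<close>
  have D: "x mod int s \<in> D \<longleftrightarrow> (\<exists>t e. x = t + int s * e \<and> t \<noteq> 0 \<and> \<bar>t\<bar> \<le> int h)" for x
    unfolding D_def using s by (intro mod_circulant_iff) auto
  have D_minus: "- x mod int s \<in> D" if x: "x mod int s \<in> D" for x
  proof -
    obtain t e where "x = t + int s * e" "t \<noteq> 0" "\<bar>t\<bar> \<le> int h" using x unfolding D by blast
    thus ?thesis unfolding D by (intro exI[of _ "- t"] exI[of _ "- e"]) auto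
  qed
  have "2 * h * (card I * nat (int p) + card C) \<le> 2 * rex (card I * nat (int p) + card C) C4"
  proof (rule rex_C4_ge_lift[where H = H and l = l and T = T and \<pi> = \<pi>])
    show "prime (int p)" using p by simp
    show "finite I" by (simp add: I_def)
    show "H i j \<Longrightarrow> i \<in> I" for i j by (simp add: H_def)
    show "H j i" if "H i j" for i j
      using that D_minus[of "j - i"] by (auto simp: H_def)
    show "\<not> H i i" for i using s by (auto simp: H_def D_def)
  next
    fix i assume i: "i \<in> I"
    have "{j. H i j} = (\<lambda>t. (i + t) mod int s) ` D"
    proof (intro equalityI subsetI)
      fix j assume "j \<in> {j. H i j}"
      hence j: "j \<in> I" "(j - i) mod int s \<in> D" by (auto simp: H_def)
      have "(i + (j - i) mod int s) mod int s = j mod int s" by (simp add: mod_add_right_eq)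
      also have "\<dots> = j" using j by (simp add: I_def)
      finally show "j \<in> (\<lambda>t. (i + t) mod int s) ` D" using j by (metis image_eqI)
    next
      fix j assume "j \<in> (\<lambda>t. (i + t) mod int s) ` D"
      then obtain t where t: "t \<in> D" "j = (i + t) mod int s" by blast
      have "(j - i) mod int s = t mod int s" by (simp add: t mod_diff_left_eq)
      also have "\<dots> = t" using t(1) s by (auto simp: D_def)
      finally show "j \<in> {j. H i j}" using t i s by (simp add: H_def I_def)
    qed
    moreover have "inj_on (\<lambda>t. (i + t) mod int s) D"
    proof (rule inj_onI)
      fix t t' assume t: "t \<in> D" "t' \<in> D" "(i + t) mod int s = (i + t') mod int s"
      hence "(i + t - i) mod int s = (i + t' - i) mod int s" by (metis mod_diff_left_eq)
      thus "t = t'" using t(1,2) s by (auto simp: D_def)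
    qed
    moreover have "card D = 2 * h"
      unfolding D_def using s by (subst card_Un_disjoint) auto
    ultimately show "card {j. H i j} = 2 * h" by (simp add: card_image)
  next
    fix i j j' assume h1: "H i j" and h2: "H i j'" and c: "[l j = l j'] (mod int p)"
    obtain t e where t: "j - i = t + int s * e" "\<bar>t\<bar> \<le> int h" using h1 unfolding H_def D by blast
    obtain t' e' where t': "j' - i = t' + int s * e'" "\<bar>t'\<bar> \<le> int h" using h2 unfolding H_def D by blast
    have jj: "\<bar>j - j'\<bar> < int s" using h1 h2 by (auto simp: H_def I_def)
    have "l j \<in> {0..<int p}" "l j' \<in> {0..<int p}"
      using h q by (auto simp: l_def intro: less_le_trans[OF pos_mod_bound])
    hence "j mod int q = j' mod int q"
      using c by (auto simp: l_def unique_euclidean_semiring_class.cong_def)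
    hence "int q dvd j - j'" by (simp add: mod_eq_dvd_iff)
    then obtain r where r: "j - j' = int q * r" by blast
    define m where "m = e - e'"
    have eq: "int q * r = (t - t') + int s * m"
      using t t' r by (simp add: m_def algebra_simps)
    have q0: "int q > 0" using h by linarith
    \<comment> \<open>Representatives differ by less than \<open>s \<le> 3 * q\<close>, so at most
      two multiples of \<open>q\<close> separate them.\<close>
    have "int q * \<bar>r\<bar> < int s" using jj unfolding r abs_mult by simp
    also have "\<dots> \<le> int q * 3" using q(3) by linarith
    finally have "int q * \<bar>r\<bar> < int q * 3" .
    hence "\<bar>r\<bar> < 3" using q0 by (simp add: mult_less_cancel_left_pos)
    hence "r \<in> {-2, -1, 0, 1, 2}" by auto
    hence qr: "\<bar>int q * r\<bar> \<le> 2 * int q" using q0 by auto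
    have tt: "\<bar>t - t'\<bar> \<le> 2 * int h" using t t' by linarith
    \<comment> \<open>Going once around the cycle would need \<open>|j - j'| \<ge> s - 2h > 2q\<close>.\<close>
    have "m = 0"
    proof (rule ccontr)
      assume "m \<noteq> 0"
      hence "int s * 1 \<le> int s * \<bar>m\<bar>" by (intro mult_left_mono) auto
      hence "int s \<le> \<bar>int s * m\<bar>" by (simp add: abs_mult)
      thus False using qr tt eq q by linarith
    qed
    hence "int q * \<bar>r\<bar> \<le> 2 * int h" using eq tt by (simp flip: abs_mult[of "int q", simplified])
    hence "int q * \<bar>r\<bar> < int q * 1" using h by linarith
    hence "r = 0" using q0 by (simp add: mult_less_cancel_left_pos)
    thus "j = j'" using r by simp
  next
    show "C \<subseteq> I" using k by (auto simp: C_def I_def)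
    show "\<pi> c \<in> C" if "c \<in> C" for c
    proof (cases "even c")
      case True
      then obtain x where "c = 2 * x" by blast
      thus ?thesis using that by (auto simp: \<pi>_def C_def)
    next
      case False
      then obtain x where "c = 2 * x + 1" by (rule oddE)
      thus ?thesis using that by (auto simp: \<pi>_def C_def)
    qed
    show "\<pi> (\<pi> c) = c" for c by (simp add: \<pi>_def)
    show "H c (\<pi> c)" if "c \<in> C" for c
    proof -
      have "\<exists>t e. \<pi> c - c = t + int s * e \<and> t \<noteq> 0 \<and> \<bar>t\<bar> \<le> int h"
        using h by (intro exI[of _ "\<pi> c - c"] exI[of _ 0]) (auto simp: \<pi>_def)
      thus ?thesis
        unfolding H_def D using that \<open>C \<subseteq> I\<close> \<open>\<And>c. c \<in> C \<Longrightarrow> \<pi> c \<in> C\<close> by blast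
    qed
    show "T c \<subseteq> {0..<int p}" for c by (auto simp: T_def)
    show "card (T c) = 2 * h" for c
    proof -
      have hp: "2 * int h \<le> int p" using h q by linarith
      show ?thesis
      proof (cases "even c")
        case True
        hence "T c = {0..<2 * int h}" using hp by (auto simp: T_def)
        thus ?thesis by simp
      next
        case False
        define a where "a = l c * l (c - 1)"
        \<comment> \<open>Reflection in \<open>a\<close> is an involution of the residues, hence it
          preserves cardinality.\<close>
        have inv: "(a - (a - y) mod int p) mod int p = y" if "y \<in> {0..<int p}" for y
        proof -
          have "(a - (a - y) mod int p) mod int p = y mod int p" by (simp add: mod_diff_right_eq)
          thus ?thesis using that by simp
        qed
        have "T c = (\<lambda>y. (a - y) mod int p) ` {0..<2 * int h}"
        proof (intro equalityI subsetI)
          fix y assume y: "y \<in> T c"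
          hence "(a - y) mod int p \<in> {0..<2 * int h}" "y \<in> {0..<int p}"
            using False by (auto simp: T_def a_def)
          thus "y \<in> (\<lambda>y. (a - y) mod int p) ` {0..<2 * int h}" using inv[of y] by (metis image_eqI)
        next
          fix y assume "y \<in> (\<lambda>y. (a - y) mod int p) ` {0..<2 * int h}"
          then obtain z where "z \<in> {0..<2 * int h}" "y = (a - z) mod int p" by blast
          thus "y \<in> T c" using inv[of z] hp False h by (auto simp: T_def a_def)
        qed
        moreover have "inj_on (\<lambda>y. (a - y) mod int p) {0..<2 * int h}"
          using inv hp by (intro inj_on_inverseI[where g = "\<lambda>y. (a - y) mod int p"]) auto
        ultimately show ?thesis by (simp add: card_image)
      qed
    qed
    show "y \<in> T c \<longleftrightarrow> z \<in> T (\<pi> c)"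
      if yz: "y \<in> {0..<int p}" "z \<in> {0..<int p}" "[y + z = l c * l (\<pi> c)] (mod int p)" for c y z
    proof -
      have "z = (l c * l (\<pi> c) - y) mod int p"
        using yz cong_add_iff_eq_mod by blast
      moreover have "y = (l c * l (\<pi> c) - z) mod int p"
        using yz cong_add_iff_eq_mod[of y "int p" z] by (simp add: add.commute)
      ultimately show ?thesis using yz by (auto simp: T_def \<pi>_def mult.commute)
    qed
  qed
  thus ?thesis by (simp add: I_def C_def nat_mult_distrib)
qed

section \<open>Choice of parameters and asymptotics\<close>

lemma rex_C4_ge_of_prime:
  fixes n p :: nat
  assumes p: "prime p" and n: "2 * p ^ 2 \<le> n" "n \<le> 3 * p ^ 2" "p \<ge> 7"
  shows "(real n / real p - 12) / 3 * real n \<le> 2 * real (rex n C4)"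
proof -
  \<comment> \<open>As \<open>p\<close> is odd, lowering the quotient by one flips the parity of the
    remainder, so the remainder can be made even while staying below \<open>2 * p\<close>.\<close>
  define s where "s = (if even (n - n div p * p) then n div p else n div p - 1)"
  define k where "k = (n - s * p) div 2"
  \<comment> \<open>With \<open>q\<close> at most \<open>(s + 2) / 3\<close>, the 5 gives
    \<open>2 * q + 2 * h\<close> at most s - 1/3, the strict inequality required.\<close>
  define h where "h = (s - 5) div 6"
  define q where "q = (s + 2) div 3"
  have p0: "p > 0" and "odd p" using n p prime_odd_nat[OF p] by auto
  have lo: "2 * p \<le> n div p" and hi: "n div p \<le> 3 * p"
    using n p0 div_le_mono[of "2 * p\<^sup>2" n p] div_le_mono[of n "3 * p\<^sup>2" p]
    by (simp_all add: power2_eq_square)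
  have s: "n div p - 1 \<le> s" "s \<le> n div p" by (auto simp: s_def)
  have sp: "s * p \<le> n" using s(2) by (metis div_times_less_eq_dividend dual_order.trans mult_le_mono1)
  have rest: "n - s * p < 2 * p" and even: "even (n - s * p)"
  proof -
    have m: "n = n div p * p + n mod p" "n mod p < p" using p0 by simp_all
    have "n - s * p < 2 * p \<and> even (n - s * p)"
    proof (cases "even (n - n div p * p)")
      case True
      thus ?thesis using m by (simp add: s_def minus_div_mult_eq_mod)
    next
      case False
      have "n div p = s + 1" using False lo n by (simp add: s_def)
      hence *: "n = s * p + (p + n mod p)" "n - n div p * p = n mod p"
        using m(1) by (simp_all add: algebra_simps)
      hence "n - s * p = p + n mod p" by linarith
      thus ?thesis using False \<open>odd p\<close> m(2) unfolding *(2) by simp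
    qed
    thus "n - s * p < 2 * p" "even (n - s * p)" by auto
  qed
  have nk: "n = s * p + 2 * k" using sp even by (simp add: k_def)
  have s13: "s \<ge> 13" using lo s n by linarith
  have "2 * h * (s * p + 2 * k) \<le> 2 * rex (s * p + 2 * k) C4"
  proof (rule rex_C4_ge_circulant[OF p])
    show "h \<ge> 1" "2 * h < q" "q \<le> p" "2 * q + 2 * h < s" "s \<le> 3 * q"
      using s13 s hi unfolding h_def q_def by linarith+
    \<comment> \<open>Here \<open>2 * k < 2 * p \<le> n div p \<le> s + 1\<close>, which is where
      \<open>2 * p ^ 2 \<le> n\<close> enters.\<close>
    have "n - s * p = 2 * k" using nk by linarith
    thus "2 * k \<le> s" using rest lo s by linarith
  qed
  hence "real (2 * h) * real n \<le> 2 * real (rex n C4)"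
    unfolding nk[symmetric] by (metis of_nat_le_iff of_nat_mult of_nat_numeral)
  \<comment> \<open>The 12 collects the rounding losses: 10 in \<open>h\<close>, 1 in
    \<open>s\<close> and 1 in \<open>n div p\<close>.\<close>
  moreover have "(real n / real p - 12) / 3 \<le> real (2 * h)"
  proof -
    have "s \<le> 6 * h + 10" unfolding h_def by linarith
    hence "n div p \<le> 6 * h + 11" using s by linarith
    hence "real (n div p) \<le> real (6 * h + 11)" by (subst of_nat_le_iff)
    moreover have "real n / real p < real (n div p) + 1"
      using p0 by (metis floor_divide_of_nat_eq floor_less_iff less_add_one
          of_int_of_nat_eq real_of_int_floor_add_one_gt)
    ultimately have "real n / real p < 6 * real h + 12" by simp
    thus ?thesis by simp
  qed
  hence "(real n / real p - 12) / 3 * real n \<le> real (2 * h) * real n" by (intro mult_right_mono) auto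
  ultimately show ?thesis by linarith
qed

lemma eventually_prime_square_between:
  "eventually (\<lambda>n::nat. \<exists>p. prime p \<and> p \<ge> 7 \<and> 2 * p ^ 2 \<le> n \<and> n \<le> 3 * p ^ 2) at_top"
proof -
  define x where "x n = nat \<lfloor>sqrt (real n / 2)\<rfloor>" for n :: nat
  \<comment> \<open>The ratio 9/11 lies just above sqrt(2/3), as the interval for \<open>p\<close>
    demands, and below 5/6, as Chebyshev's bounds demand.\<close>
  have "eventually (\<lambda>x::nat. \<exists>p. prime p \<and> 9 / 11 * real x < real p \<and> p \<le> x) at_top"
    by (rule eventually_prime_between) auto
  moreover have "filterlim x at_top at_top" unfolding x_def by real_asymp
  ultimately have "eventually (\<lambda>n. \<exists>p. prime p \<and> 9 / 11 * real (x n) < real p \<and> p \<le> x n) at_top"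
    by (rule eventually_compose_filterlim)
  \<comment> \<open>The \<open>w - 1\<close> allows for the floor in \<open>x\<close>. Clearing
    denominators leaves \<open>0 \<le> w * (w - 486) + 243\<close>.\<close>
  moreover have "eventually (\<lambda>w::real. 2 * w\<^sup>2 / 3 \<le> (9 / 11 * (w - 1))\<^sup>2) at_top"
    using eventually_ge_at_top[of 486]
  proof eventually_elim
    case (elim w)
    hence "0 \<le> w * (w - 486)" by simp
    thus ?case by (simp add: power2_eq_square algebra_simps)
  qed
  hence "eventually (\<lambda>n::nat. 2 * (sqrt (real n / 2))\<^sup>2 / 3 \<le> (9 / 11 * (sqrt (real n / 2) - 1))\<^sup>2) at_top"
    by (rule eventually_compose_filterlim) real_asymp
  moreover have "eventually (\<lambda>n::nat. 7 \<le> 9 / 11 * (sqrt (real n / 2) - 1)) at_top"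
    by real_asymp
  ultimately show ?thesis
  proof eventually_elim
    case (elim n)
    then obtain p where p: "prime p" "9 / 11 * real (x n) < real p" "p \<le> x n" by blast
    define w where "w = sqrt (real n / 2)"
    have x: "real (x n) \<le> w" "w - 1 \<le> real (x n)"
      unfolding x_def w_def by (auto simp: of_nat_floor)
    have "9 / 11 * (w - 1) \<le> 9 / 11 * real (x n)" using x(2) by (intro mult_left_mono) auto
    also have "\<dots> < real p" by (rule p(2))
    finally have lo: "9 / 11 * (w - 1) \<le> real p" by (rule less_imp_le)
    have hi: "real p \<le> w" using p(3) x(1) by (meson of_nat_le_iff order_trans)
    have "(real p)\<^sup>2 \<le> w\<^sup>2" using hi by (intro power_mono) auto
    hence "real (2 * p\<^sup>2) \<le> real n" by (simp add: w_def)
    moreover have w: "2 * w\<^sup>2 / 3 \<le> (9 / 11 * (w - 1))\<^sup>2" "7 \<le> 9 / 11 * (w - 1)"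
      using elim by (simp_all only: w_def)
    have "(9 / 11 * (w - 1))\<^sup>2 \<le> (real p)\<^sup>2"
      using lo w by (intro power_mono) auto
    with w have "2 * w\<^sup>2 / 3 \<le> (real p)\<^sup>2" by linarith
    hence "real n \<le> real (3 * p\<^sup>2)" by (simp add: w_def)
    ultimately have "2 * p\<^sup>2 \<le> n" "n \<le> 3 * p\<^sup>2" by (simp_all only: of_nat_le_iff)
    moreover have "7 \<le> p" using lo w by linarith
    ultimately show ?case using p by blast
  qed
qed

theorem theorem1p1:
  shows "\<exists>\<epsilon> :: nat \<Rightarrow> real. \<epsilon> \<in> o(\<lambda>_. 1) \<and>
    (\<forall>\<^sub>F n in sequentially.
       real (rex n C4) \<ge> (1 / (2 * sqrt 6) - \<epsilon> n) * real n powr (3 / 2))"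
proof (intro exI[of _ "\<lambda>_. 0"] conjI)
  \<comment> \<open>The gap between 5/4 and 7/5 absorbs the additive loss 12 for large
    \<open>n\<close>.\<close>
  have sqrt6: "3 / sqrt 6 \<le> 5 / 4"
    using real_le_rsqrt[of "12 / 5" 6] by (simp add: field_simps power2_eq_square)
  have sqrt2: "7 / 5 \<le> sqrt 2" by (intro real_le_rsqrt) (simp add: power2_eq_square)
  have "eventually (\<lambda>n::nat. 12 + 5 / 4 * sqrt (real n) \<le> 7 / 5 * sqrt (real n)) at_top"
    by real_asymp
  thus "\<forall>\<^sub>F n in sequentially. real (rex n C4) \<ge> (1 / (2 * sqrt 6) - 0) * real n powr (3 / 2)"
    using eventually_prime_square_between eventually_gt_at_top[of 0]
  proof eventually_elim
    case (elim n)
    then obtain p where p: "prime p" "p \<ge> 7" "2 * p ^ 2 \<le> n" "n \<le> 3 * p ^ 2" by blast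
    have "real (2 * p\<^sup>2) \<le> real n" using p by (subst of_nat_le_iff)
    hence "real p \<le> sqrt (real n / 2)" by (intro real_le_rsqrt) simp
    hence "real n / sqrt (real n / 2) \<le> real n / real p"
      using p elim by (intro divide_left_mono) auto
    moreover have "real n / sqrt (real n / 2) = sqrt 2 * sqrt (real n)"
      using elim by (simp add: real_sqrt_divide field_simps)
    moreover have "3 / sqrt 6 * sqrt (real n) \<le> 5 / 4 * sqrt (real n)"
      "7 / 5 * sqrt (real n) \<le> sqrt 2 * sqrt (real n)"
      using sqrt6 sqrt2 by (intro mult_right_mono; simp)+
    ultimately have "3 / sqrt 6 * sqrt (real n) + 12 \<le> real n / real p" using elim by linarith
    hence "sqrt (real n) / sqrt 6 \<le> (real n / real p - 12) / 3" 
      by (simp add: field_simps del: real_sqrt_divide)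
    hence "sqrt (real n) / sqrt 6 * real n \<le> (real n / real p - 12) / 3 * real n"
      by (intro mult_right_mono) auto
    also have "\<dots> \<le> 2 * real (rex n C4)" using p by (intro rex_C4_ge_of_prime)
    also have "sqrt (real n) / sqrt 6 * real n = real n powr (3 / 2) / sqrt 6"
      using elim powr_add[of "real n" "1 / 2" 1] by (simp add: powr_half_sqrt)
    finally show ?case by simp
  qed
qed simp

end
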